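(* Let $F$ be a field with $\operatorname{char}(F)=0$, and let $\star$ be the involution on the algebra $UT_2(F)$ of $2\times 2$ upper triangular matrices given by $$\begin{pmatrix} a&c\\0&b\end{pmatrix}^{\star}=\begin{pmatrix} b&c\\0&a\end{pmatrix}\qquad (a,b,c\in F).$$ The set of all $*$-central polynomials of $(UT_2(F),\star)$ is $$C(UT_2(F),\star)=Id(UT_2(F),\star)+\langle z_1z_2\rangle^{TS( * )}+F .$$
   Context: All algebras are unitary and associative over $F$. Let $X=\{x_1,x_2,\ldots\}$ and $X^*=\{x_1^*,x_2^*,\ldots\}$ be disjoint infinite sets, and let $F\langle X\cup X^*\rangle$ be the free unitary associative $F$-algebra freely generated by $X\cup X^*$, with the $F$-linear involution $*$ determined by $x_i\leftrightarrow x_i^*$. Put $y_i=x_i+x_i^*$, $z_i=x_i-x_i^*$, $Y=\{y_1,y_2,\ldots\}$, $Z=\{z_1,z_2,\ldots\}$. Then $F\langle X\cup X^*\rangle=F\langle Y\cup Z\rangle$ is free on $Y\cup Z$, with $y_i^*=y_i$ and $z_i^*=-z_i$. For an algebra $A$ with involution $\circledast$, put $A^+=\{a\in A: a^\circledast=a\}$, $A^-=\{a\in A:a^\circledast=-a\}$. A polynomial $f(y_1,\ldots,y_n,z_1,\ldots,z_m)$ belongs to $Id(A,\circledast)$ (is a $*$-polynomial identity) if $f(a_1,\ldots,a_n,b_1,\ldots,b_m)=0$ for all $a_i\in A^+$, $b_j\in A^-$; it belongs to $C(A,\circledast)$ (is a $*$-central polynomial) if $f(a_1,\ldots,a_n,b_1,\ldots,b_m)\in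 Z(A)$, the center of $A$, for all $a_i\in A^+$, $b_j\in A^-$. A $*$-endomorphism of $F\langle Y\cup Z\rangle$ is a (unital) algebra endomorphism commuting with $*$. A $T( * )$-space is a vector subspace of $F\langle Y\cup Z\rangle$ closed under all $*$-endomorphisms; $\langle W\rangle^{TS( * )}$ is the smallest $T( * )$-space containing $W$. Equivalently it is spanned by all $f(g_1,\ldots,g_n,h_1,\ldots,h_m)$ with $f(y_1,\ldots,y_n,z_1,\ldots,z_m)\in W$, $g_i\in F\langle Y\cup Z\rangle^+$, $h_j\in F\langle Y\cup Z\rangle^-$. Here $F$ denotes the constant polynomials and $+$ the sum of vector subspaces. *)

theory Defs
  imports
    "HOL-Analysis.Cartesian_Space"
    "HOL-Library.Poly_Mapping"
    "HOL-Library.Set_Algebras"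
begin

section \<open>Algebras with involution\<close>

text \<open>
  A unital associative algebra over the field \<open>'k\<close> is a type of class \<open>ring_1\<close> together with a
  scalar multiplication \<open>scale\<close>.
\<close>

locale involution_algebra = vector_space scale
  for scale :: "'k::field \<Rightarrow> 'a::ring_1 \<Rightarrow> 'a" +
  fixes star :: "'a \<Rightarrow> 'a"
  assumes scale_mult_left: "scale c (a * b) = scale c a * b"
    and scale_mult_right: "scale c (a * b) = a * scale c b"
    and star_add: "star (a + b) = star a + star b"
    and star_scale: "star (scale c a) = scale c (star a)"
    and star_mult: "star (a * b) = star b * star a"
    and star_star: "star (star a) = a"

definition symmetric_elements :: "('a::ring_1 \<Rightarrow> 'a) \<Rightarrow> 'a set" where
  "symmetric_elements star = {a. star a = a}"

definition skew_elements :: "('a::ring_1 \<Rightarrow> 'a) \<Rightarrow> 'a set" where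
  "skew_elements star = {a. star a = - a}"

definition algebra_center :: "'a::ring_1 set" where
  "algebra_center = {a. \<forall>b. a * b = b * a}"


section \<open>The free algebra with involution\<close>

text \<open>
  The free algebra on \<open>Y \<union> Z\<close> is the monoid algebra of the free monoid of words in the
  generators. In characteristic different from 2 it is the free algebra on
  \<open>x\<^sub>i = (y\<^sub>i + z\<^sub>i) / 2\<close> and \<open>x\<^sub>i\<^sup>* = (y\<^sub>i - z\<^sub>i) / 2\<close>. Generators are indexed by all of \<open>nat\<close>, so there
  are also generators with index \<open>0\<close>.

  The product of \<open>poly_mapping\<close> is convolution along the addition of the exponents; words
  therefore form an additively written, noncommutative monoid.
\<close>

datatype generator = Y nat | Z nat

datatype word = Word (letters: "generator list")

instantiation word :: monoid_add
begin

definition zero_word :: word where "0 = Word []"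

definition plus_word :: "word \<Rightarrow> word \<Rightarrow> word" where
  "v + w = Word (letters v @ letters w)"

instance
  by standard (simp_all add: zero_word_def plus_word_def)

end

lemma letters_zero [simp]: "letters 0 = []"
  and letters_plus [simp]: "letters (v + w) = letters v @ letters w"
  by (simp_all add: zero_word_def plus_word_def)

type_synonym 'k star_poly = "word \<Rightarrow>\<^sub>0 'k"

definition poly_scale :: "'k::field \<Rightarrow> 'k star_poly \<Rightarrow> 'k star_poly" where
  "poly_scale c f = Poly_Mapping.map ((*) c) f"

definition var :: "generator \<Rightarrow> 'k::field star_poly" where
  "var g = Poly_Mapping.single (Word [g]) 1"

abbreviation y_var :: "nat \<Rightarrow> 'k::field star_poly" where
  "y_var i \<equiv> var (Y i)"

abbreviation z_var :: "nat \<Rightarrow> 'k::field star_poly" where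
  "z_var i \<equiv> var (Z i)"

definition constants :: "'k::field star_poly set" where
  "constants = range (\<lambda>c. poly_scale c 1)"

primrec star_var :: "generator \<Rightarrow> 'k::field star_poly" where
  "star_var (Y i) = y_var i"
| "star_var (Z i) = - z_var i"

definition poly_star :: "'k::field star_poly \<Rightarrow> 'k star_poly" where
  "poly_star f = (\<Sum>w\<in>Poly_Mapping.keys f.
     poly_scale (Poly_Mapping.lookup f w) (prod_list (rev (map star_var (letters w)))))"

text \<open>
  The value of \<open>f\<close> when \<open>a i\<close> is substituted for \<open>y\<^sub>i\<close> and \<open>b i\<close> for \<open>z\<^sub>i\<close>. Only finitely many
  generators occur in \<open>f\<close>, so the remaining values are irrelevant.
\<close>

definition poly_eval ::
  "('k::field \<Rightarrow> 'a::ring_1 \<Rightarrow> 'a) \<Rightarrow> (nat \<Rightarrow> 'a) \<Rightarrow> (nat \<Rightarrow> 'a) \<Rightarrow> 'k star_poly \<Rightarrow> 'a" where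
  "poly_eval smul a b f = (\<Sum>w\<in>Poly_Mapping.keys f.
     smul (Poly_Mapping.lookup f w) (prod_list (map (case_generator a b) (letters w))))"

definition star_identities ::
  "('k::field \<Rightarrow> 'a::ring_1 \<Rightarrow> 'a) \<Rightarrow> ('a \<Rightarrow> 'a) \<Rightarrow> 'k star_poly set" where
  "star_identities smul star = {f. \<forall>a b.
     (\<forall>i. a i \<in> symmetric_elements star) \<longrightarrow> (\<forall>j. b j \<in> skew_elements star) \<longrightarrow>
       poly_eval smul a b f = 0}"

definition star_central_polynomials ::
  "('k::field \<Rightarrow> 'a::ring_1 \<Rightarrow> 'a) \<Rightarrow> ('a \<Rightarrow> 'a) \<Rightarrow> 'k star_poly set" where
  "star_central_polynomials smul star = {f. \<forall>a b.
     (\<forall>i. a i \<in> symmetric_elements star) \<longrightarrow> (\<forall>j. b j \<in> skew_elements star) \<longrightarrow>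
       poly_eval smul a b f \<in> algebra_center}"

definition star_endomorphism :: "('k::field star_poly \<Rightarrow> 'k star_poly) \<Rightarrow> bool" where
  "star_endomorphism \<phi> \<longleftrightarrow>
     Vector_Spaces.linear poly_scale poly_scale \<phi> \<and>
     \<phi> 1 = 1 \<and> (\<forall>f g. \<phi> (f * g) = \<phi> f * \<phi> g) \<and>
     (\<forall>f. \<phi> (poly_star f) = poly_star (\<phi> f))"

definition T_star_space :: "'k::field star_poly set \<Rightarrow> bool" where
  "T_star_space V \<longleftrightarrow>
     module.subspace poly_scale V \<and> (\<forall>\<phi>. star_endomorphism \<phi> \<longrightarrow> \<phi> ` V \<subseteq> V)"

definition T_star_space_generated :: "'k::field star_poly set \<Rightarrow> 'k star_poly set" where
  "T_star_space_generated W = T_star_space hull W"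


subsection \<open>The involution laws\<close>

lemma lookup_poly_scale [simp]:
  "Poly_Mapping.lookup (poly_scale c f) w = c * Poly_Mapping.lookup f w"
  by (simp add: poly_scale_def Poly_Mapping.map.rep_eq when_def)

lemma poly_scale_conv_mult: "poly_scale c f = Poly_Mapping.single 0 c * f"
  by (simp add: poly_scale_def mult_map_scale_conv_mult)

lemma single_conv_poly_scale: "Poly_Mapping.single w c = poly_scale c (Poly_Mapping.single w 1)"
  by (simp add: poly_scale_conv_mult mult_single)

interpretation poly: vector_space "poly_scale :: 'k::field \<Rightarrow> _"
  by standard (auto intro!: poly_mapping_eqI simp: lookup_add algebra_simps)

lemma poly_scale_mult_left: "poly_scale c (f * g) = poly_scale c f * g"
  by (simp add: poly_scale_conv_mult mult.assoc)

lemma poly_scale_sum_single: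
  "f = (\<Sum>w\<in>Poly_Mapping.keys f. poly_scale (Poly_Mapping.lookup f w) (Poly_Mapping.single w 1))"
  by (rule poly_mapping_eqI)
    (auto simp: lookup_sum lookup_single when_def in_keys_iff if_distrib cong: if_cong)

lemma single_mult_comm:
  "Poly_Mapping.single (0::word) (c::'k::field) * f = f * Poly_Mapping.single 0 c"
proof -
  have "Poly_Mapping.single 0 c * poly_scale d (Poly_Mapping.single w 1)
      = poly_scale d (Poly_Mapping.single w 1) * Poly_Mapping.single 0 c" for d and w :: word
    by (simp add: single_conv_poly_scale [symmetric] mult_single mult.commute)
  then have "Poly_Mapping.single (0::word) c *
        (\<Sum>w\<in>Poly_Mapping.keys f. poly_scale (Poly_Mapping.lookup f w) (Poly_Mapping.single w 1))
      = (\<Sum>w\<in>Poly_Mapping.keys f. poly_scale (Poly_Mapping.lookup f w) (Poly_Mapping.single w 1)) *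
        Poly_Mapping.single 0 c"
    by (simp only: sum_distrib_left sum_distrib_right)
  then show ?thesis
    by (simp only: poly_scale_sum_single [symmetric])
qed

lemma poly_scale_mult_right: "poly_scale c (f * g) = f * poly_scale c g"
  by (metis mult.assoc poly_scale_conv_mult single_mult_comm)

lemma word_sum_superset:
  assumes "finite S" "Poly_Mapping.keys f \<subseteq> S"
  shows "(\<Sum>w\<in>Poly_Mapping.keys f. poly_scale (Poly_Mapping.lookup f w) (h w))
       = (\<Sum>w\<in>S. poly_scale (Poly_Mapping.lookup f w) (h w))"
  using assms by (intro sum.mono_neutral_left) (auto simp: in_keys_iff)

lemma poly_star_add: "poly_star (f + g) = poly_star f + poly_star g"
proof -
  let ?S = "Poly_Mapping.keys f \<union> Poly_Mapping.keys g"
  have "Poly_Mapping.keys (f + g) \<subseteq> ?S"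
    by (rule keys_add)
  then show ?thesis
    unfolding poly_star_def
    by (subst word_sum_superset [of ?S "f + g"])
      (simp_all add: word_sum_superset [of ?S f] word_sum_superset [of ?S g]
        lookup_add poly.scale_left_distrib sum.distrib)
qed

lemma poly_star_scale: "poly_star (poly_scale c f) = poly_scale c (poly_star f)"
proof -
  have "Poly_Mapping.keys (poly_scale c f) \<subseteq> Poly_Mapping.keys f"
    by (auto simp: in_keys_iff)
  then show ?thesis
    unfolding poly_star_def
    by (subst word_sum_superset [of "Poly_Mapping.keys f" "poly_scale c f"])
      (simp_all add: poly.scale_sum_right)
qed

lemma poly_star_zero: "poly_star 0 = 0"
  by (simp add: poly_star_def)

lemma poly_star_sum: "poly_star (sum h S) = (\<Sum>s\<in>S. poly_star (h s))"
  by (induction S rule: infinite_finite_induct) (simp_all add: poly_star_zero poly_star_add)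

lemma poly_star_single:
  "poly_star (Poly_Mapping.single w (1::'k::field)) = prod_list (rev (map star_var (letters w)))"
  by (simp add: poly_star_def)

lemma poly_star_mult: "poly_star (f * g) = poly_star g * poly_star (f :: 'k::field star_poly)"
proof -
  have mono: "poly_star (poly_scale c (Poly_Mapping.single v 1) * poly_scale d (Poly_Mapping.single w 1))
      = poly_star (poly_scale d (Poly_Mapping.single w 1)) *
        poly_star (poly_scale c (Poly_Mapping.single v (1::'k)))" for c d v w
  proof -
    have "poly_scale c (Poly_Mapping.single v (1::'k)) * poly_scale d (Poly_Mapping.single w 1)
        = poly_scale c (poly_scale d (Poly_Mapping.single (v + w) 1))"
      by (simp only: poly_scale_mult_left [symmetric] poly_scale_mult_right [symmetric]
          mult_single mult_1 poly.scale_left_commute [of c d])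
    then show ?thesis
      by (simp only: poly_star_scale poly_star_single letters_plus map_append rev_append
          prod_list.append poly_scale_mult_left [symmetric] poly_scale_mult_right [symmetric]
          poly.scale_left_commute [of c d])
  qed
  define t where "t h w = poly_scale (Poly_Mapping.lookup h w) (Poly_Mapping.single w (1::'k))"
    for h :: "'k star_poly" and w
  have t: "poly_star (t f v * t g w) = poly_star (t g w) * poly_star (t f v)" for v w
    by (simp only: t_def mono)
  have sum_t: "h = (\<Sum>w\<in>Poly_Mapping.keys h. t h w)" for h
    unfolding t_def by (rule poly_scale_sum_single)
  have "poly_star (f * g)
      = poly_star ((\<Sum>v\<in>Poly_Mapping.keys f. t f v) * (\<Sum>w\<in>Poly_Mapping.keys g. t g w))"
    by (simp only: sum_t [symmetric])
  also have "\<dots> = (\<Sum>v\<in>Poly_Mapping.keys f. \<Sum>w\<in>Poly_Mapping.keys g.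
      poly_star (t g w) * poly_star (t f v))"
    by (simp only: sum_product poly_star_sum t)
  also have "\<dots> = (\<Sum>w\<in>Poly_Mapping.keys g. \<Sum>v\<in>Poly_Mapping.keys f.
      poly_star (t g w) * poly_star (t f v))"
    by (rule sum.swap)
  also have "\<dots> = poly_star (\<Sum>w\<in>Poly_Mapping.keys g. t g w) *
      poly_star (\<Sum>v\<in>Poly_Mapping.keys f. t f v)"
    by (simp only: sum_product poly_star_sum)
  also have "\<dots> = poly_star g * poly_star f"
    by (simp only: sum_t [symmetric])
  finally show ?thesis .
qed

lemma poly_star_uminus: "poly_star (- f) = - poly_star f"
  by (metis add.right_inverse add_eq_0_iff poly_star_add poly_star_zero)

lemma poly_star_one: "poly_star (1 :: 'k::field star_poly) = 1"
  using poly_star_single [of 0, where 'k = 'k] by (simp add: single_one)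

lemma poly_star_var: "poly_star (var g) = star_var g"
  by (simp add: var_def poly_star_single)

lemma poly_star_star_var: "poly_star (star_var g) = var g"
  by (cases g) (simp_all add: poly_star_uminus poly_star_var)

lemma prod_list_var: "prod_list (map var (letters w)) = Poly_Mapping.single w (1::'k::field)"
proof -
  have "prod_list (map var l) = Poly_Mapping.single (Word l) (1::'k)" for l
  proof (induction l)
    case Nil
    show ?case by (simp add: zero_word_def [symmetric])
  next
    case (Cons g l)
    then show ?case by (simp add: var_def mult_single plus_word_def)
  qed
  then show ?thesis by (cases w) simp
qed

lemma poly_star_star: "poly_star (poly_star f) = (f :: 'k::field star_poly)"
proof -
  have "poly_star (prod_list (rev l)) = prod_list (map poly_star l)" for l :: "'k star_poly list"
    by (induction l) (simp_all add: poly_star_one poly_star_mult)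
  then have "poly_star (poly_star (Poly_Mapping.single w (1::'k))) = Poly_Mapping.single w 1" for w
    by (simp add: poly_star_single poly_star_star_var prod_list_var o_def)
  then have "poly_star (poly_star
        (\<Sum>w\<in>Poly_Mapping.keys f. poly_scale (Poly_Mapping.lookup f w) (Poly_Mapping.single w 1)))
      = (\<Sum>w\<in>Poly_Mapping.keys f. poly_scale (Poly_Mapping.lookup f w) (Poly_Mapping.single w 1))"
    by (simp only: poly_star_sum poly_star_scale)
  then show ?thesis
    by (simp only: poly_scale_sum_single [symmetric])
qed

interpretation poly: involution_algebra "poly_scale :: 'k::field \<Rightarrow> _" poly_star
  by standard (fact poly_scale_mult_left poly_scale_mult_right poly_star_add poly_star_scale
    poly_star_mult poly_star_star)+


section \<open>Upper triangular matrices of size 2\<close>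

text \<open>
  A separate type is used because the product \<open>(*)\<close> on the type of matrices is entrywise; the
  matrix product is \<open>(**)\<close>.
\<close>

typedef (overloaded) 'k ut2 = "{A :: 'k::field ^ 2 ^ 2. A $ 2 $ 1 = 0}"
  morphisms matrix_of Ut2
  by (rule exI [of _ 0]) simp

setup_lifting type_definition_ut2

instantiation ut2 :: (field) ring_1
begin

lift_definition zero_ut2 :: "'a ut2" is 0 by simp

lift_definition one_ut2 :: "'a ut2" is "mat 1" by (simp add: mat_def)

lift_definition plus_ut2 :: "'a ut2 \<Rightarrow> 'a ut2 \<Rightarrow> 'a ut2" is "(+)" by simp

lift_definition minus_ut2 :: "'a ut2 \<Rightarrow> 'a ut2 \<Rightarrow> 'a ut2" is "(-)" by simp

lift_definition uminus_ut2 :: "'a ut2 \<Rightarrow> 'a ut2" is uminus by simp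

lift_definition times_ut2 :: "'a ut2 \<Rightarrow> 'a ut2 \<Rightarrow> 'a ut2" is "(**)"
  by (simp add: matrix_matrix_mult_def sum_2)

instance
proof
  show "(0 :: 'a ut2) \<noteq> 1"
    by transfer (auto simp: mat_def vec_eq_iff)
  fix A B C :: "'a ut2"
  show "A * B * C = A * (B * C)"
    by transfer (simp add: matrix_mul_assoc)
  show "(A + B) * C = A * C + B * C"
    by transfer (simp add: vec_eq_iff matrix_matrix_mult_def distrib_right sum.distrib)
  show "A * (B + C) = A * B + A * C"
    by transfer (simp add: matrix_add_ldistrib)
  show "1 * A = A" by transfer simp
  show "A * 1 = A" by transfer simp
  show "A + B + C = A + (B + C)" by transfer (rule add.assoc)
  show "A + B = B + A" by transfer (rule add.commute)
  show "0 + A = A" by transfer simp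
  show "- A + A = 0" by transfer simp
  show "A - B = A + - B" by transfer simp
qed

end

lift_definition ut2_scale :: "'k::field \<Rightarrow> 'k ut2 \<Rightarrow> 'k ut2" is
  "\<lambda>c A. \<chi> i j. c * A $ i $ j"
  by simp

lift_definition ut2_star :: "'k::field ut2 \<Rightarrow> 'k ut2" is
  "\<lambda>A. vector [vector [A $ 2 $ 2, A $ 1 $ 2], vector [0, A $ 1 $ 1]]"
  by simp

interpretation ut2: involution_algebra "ut2_scale :: 'k::field \<Rightarrow> _" ut2_star
proof
  fix c d :: 'k and A B :: "'k ut2"
  show "ut2_scale c (A + B) = ut2_scale c A + ut2_scale c B"
    and "ut2_scale (c + d) A = ut2_scale c A + ut2_scale d A"
    and "ut2_scale c (ut2_scale d A) = ut2_scale (c * d) A"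
    and "ut2_scale 1 A = A"
    by (transfer; simp add: vec_eq_iff algebra_simps)+
  show "ut2_scale c (A * B) = ut2_scale c A * B"
    and "ut2_scale c (A * B) = A * ut2_scale c B"
    by (transfer; simp add: vec_eq_iff matrix_matrix_mult_def sum_distrib_left mult_ac)+
  show "ut2_star (A + B) = ut2_star A + ut2_star B"
    and "ut2_star (ut2_scale c A) = ut2_scale c (ut2_star A)"
    and "ut2_star (ut2_star A) = A"
    by (transfer; simp add: vec_eq_iff forall_2)+
  show "ut2_star (A * B) = ut2_star B * ut2_star A"
    by (transfer; simp add: vec_eq_iff forall_2 matrix_matrix_mult_def sum_2 mult_ac add.commute)
qed

end

theory Submission
  imports Defs "HOL-Computational_Algebra.Polynomial"
begin

text \<open>
  At \<open>y\<^sub>i = a\<^sub>i 1 + c\<^sub>i e\<^sub>1\<^sub>2\<close> and \<open>z\<^sub>j = d\<^sub>j (e\<^sub>1\<^sub>1 - e\<^sub>2\<^sub>2)\<close>, the diagonal of a word is \<open>\<delta> (1, \<plusminus>1)\<close>, where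
  \<open>\<delta>\<close> is the product of the \<open>a\<^sub>i\<close> and \<open>d\<^sub>j\<close> occurring in it and the sign is the parity of its degree in
  the \<open>z\<^sub>j\<close>. Hence the value of a central polynomial is a scalar to which only words of even degree in
  the \<open>z\<^sub>j\<close> contribute. If that degree is positive, the contribution \<open>\<delta> 1\<close> of a word \<open>p z\<^sub>j q\<close> is also
  the value of \<open>(1/2) (pq - (pq)\<^sup>*) z\<^sub>j\<close>, a product of two skew polynomials. The words in the \<open>y\<^sub>i\<close>
  alone contribute a polynomial in the \<open>a\<^sub>i\<close> whose derivatives are entries of central values and
  therefore vanish, so in characteristic 0 it is constant.
\<close>

section \<open>Evaluation of star polynomials\<close>

text \<open>A polynomial is the sum of its terms, so additive claims need checking only on multiples
  of words.\<close>

lemma star_poly_induct [case_names zero monomial add]: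
  fixes f :: "'k::field star_poly"
  assumes "P 0"
    and "\<And>c w. P (poly_scale c (Poly_Mapping.single w 1))"
    and "\<And>f g. P f \<Longrightarrow> P g \<Longrightarrow> P (f + g)"
  shows "P f"
proof -
  have "P (\<Sum>w\<in>S. poly_scale (Poly_Mapping.lookup f w) (Poly_Mapping.single w 1))" for S
    by (induction S rule: infinite_finite_induct) (simp_all add: assms)
  then show ?thesis
    using poly_scale_sum_single [of f] by metis
qed

context involution_algebra
begin

lemma star_zero: "star 0 = 0"
  using star_add [of 0 0] by simp

lemma star_one: "star 1 = 1"
  by (metis mult_1 mult_1_right star_mult star_star)

lemma star_uminus: "star (- a) = - star a"
  by (metis add.right_inverse add_eq_0_iff star_add star_zero)

lemma skew_elements_minus_star: "scale c (a - star a) \<in> skew_elements star"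
proof -
  have "star (a - star a) = - (a - star a)"
    using star_add [of a "- star a"] by (simp add: star_uminus star_star)
  then show ?thesis
    by (simp only: skew_elements_def mem_Collect_eq star_scale scale_minus_right)
qed

text \<open>Supports can shrink by cancellation; over a common finite superset linearity becomes
  termwise.\<close>

lemma poly_eval_superset:
  assumes "finite S" "Poly_Mapping.keys f \<subseteq> S"
  shows "poly_eval scale a b f =
    (\<Sum>w\<in>S. scale (Poly_Mapping.lookup f w) (prod_list (map (case_generator a b) (letters w))))"
  unfolding poly_eval_def using assms by (intro sum.mono_neutral_left) (auto simp: in_keys_iff)

lemma poly_eval_add: "poly_eval scale a b (f + g) = poly_eval scale a b f + poly_eval scale a b g"
proof -
  let ?S = "Poly_Mapping.keys f \<union> Poly_Mapping.keys g"
  have "Poly_Mapping.keys (f + g) \<subseteq> ?S"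
    by (rule keys_add)
  then show ?thesis
    by (simp add: poly_eval_superset [of ?S] lookup_add scale_left_distrib sum.distrib)
qed

lemma poly_eval_scale: "poly_eval scale a b (poly_scale c f) = scale c (poly_eval scale a b f)"
proof -
  have "Poly_Mapping.keys (poly_scale c f) \<subseteq> Poly_Mapping.keys f"
    by (auto simp: in_keys_iff)
  then show ?thesis
    by (simp add: poly_eval_superset [of "Poly_Mapping.keys f"] scale_sum_right)
qed

lemma poly_eval_single [simp]:
  "poly_eval scale a b (Poly_Mapping.single w 1) = prod_list (map (case_generator a b) (letters w))"
  by (simp add: poly_eval_def)

lemma poly_eval_zero [simp]: "poly_eval scale a b 0 = 0"
  by (simp add: poly_eval_def)

lemma poly_eval_one [simp]: "poly_eval scale a b 1 = 1"
  using poly_eval_single [of a b 0] by (simp add: single_one)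

lemma poly_eval_var [simp]: "poly_eval scale a b (var g) = case_generator a b g"
  by (simp add: var_def)

lemma poly_eval_uminus: "poly_eval scale a b (- f) = - poly_eval scale a b f"
  by (metis add.right_inverse add_eq_0_iff poly_eval_add poly_eval_zero)

lemma poly_eval_diff: "poly_eval scale a b (f - g) = poly_eval scale a b f - poly_eval scale a b g"
  using poly_eval_add [of a b f "- g"] by (simp add: poly_eval_uminus)

lemma poly_eval_sum: "poly_eval scale a b (sum h S) = (\<Sum>s\<in>S. poly_eval scale a b (h s))"
  by (induction S rule: infinite_finite_induct) (simp_all add: poly_eval_add)

lemma poly_eval_mult: "poly_eval scale a b (f * g) = poly_eval scale a b f * poly_eval scale a b g"
proof (induction f rule: star_poly_induct)
  case (monomial c v)
  show ?case
  proof (induction g rule: star_poly_induct)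
    case (monomial d w)
    have "poly_scale c (Poly_Mapping.single v 1) * poly_scale d (Poly_Mapping.single w 1) =
        poly_scale (c * d) (Poly_Mapping.single (v + w) 1)"
      by (simp only: poly_scale_mult_left [symmetric] poly_scale_mult_right [symmetric]
          mult_single mult_1 poly.scale_scale mult.commute)
    then show ?case
      by (simp add: poly_eval_scale scale_mult_left [symmetric] scale_mult_right [symmetric] mult.commute)
  qed (simp_all add: distrib_left poly_eval_add)
qed (simp_all add: distrib_right poly_eval_add)

text \<open>The assumptions give the claim on generators; both involutions reverse products, so it
  extends to words.\<close>

lemma poly_eval_star:
  assumes "\<And>i. a i \<in> symmetric_elements star" "\<And>j. b j \<in> skew_elements star"
  shows "poly_eval scale a b (poly_star f) = star (poly_eval scale a b f)"
proof -
  have "poly_eval scale a b (star_var g) = star (case_generator a b g)" for g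
    using assms by (cases g) (auto simp: symmetric_elements_def skew_elements_def poly_eval_uminus)
  then have "poly_eval scale a b (prod_list (rev (map star_var l))) =
      star (prod_list (map (case_generator a b) l))" for l
    by (induction l) (simp_all add: star_one star_mult poly_eval_mult)
  then show ?thesis
    by (induction f rule: star_poly_induct)
      (simp_all add: star_zero star_add poly_star_zero poly_star_add poly_eval_add poly_star_scale
        poly_eval_scale star_scale poly_star_single)
qed

lemma symmetric_poly_eval:
  assumes "\<And>i. a i \<in> symmetric_elements star" "\<And>j. b j \<in> skew_elements star"
    and "f \<in> symmetric_elements poly_star"
  shows "poly_eval scale a b f \<in> symmetric_elements star"
  using assms poly_eval_star [of a b f] by (simp add: symmetric_elements_def)

lemma skew_poly_eval:
  assumes "\<And>i. a i \<in> symmetric_elements star" "\<And>j. b j \<in> skew_elements star"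
    and "f \<in> skew_elements poly_star"
  shows "poly_eval scale a b f \<in> skew_elements star"
  using assms poly_eval_star [of a b f] by (simp add: skew_elements_def poly_eval_uminus)

section \<open>Star-endomorphisms and T-star-spaces\<close>

lemma poly_eval_star_endomorphism:
  assumes "star_endomorphism \<phi>"
  shows "poly_eval scale a b (\<phi> f) =
    poly_eval scale (\<lambda>i. poly_eval scale a b (\<phi> (y_var i))) (\<lambda>j. poly_eval scale a b (\<phi> (z_var j))) f"
proof -
  interpret \<phi>: Vector_Spaces.linear poly_scale poly_scale \<phi>
    using assms by (simp add: star_endomorphism_def)
  have mult: "\<phi> (f * g) = \<phi> f * \<phi> g" and one: "\<phi> 1 = 1" for f g
    using assms by (simp_all add: star_endomorphism_def)
  \<comment> \<open>Both sides are unital homomorphisms in \<open>f\<close>, so agreement on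
    generators gives agreement on words.\<close>
  have "poly_eval scale a b (\<phi> (prod_list (map var l))) = prod_list (map (case_generator
      (\<lambda>i. poly_eval scale a b (\<phi> (y_var i))) (\<lambda>j. poly_eval scale a b (\<phi> (z_var j)))) l)" for l
    by (induction l) (simp_all add: one mult poly_eval_mult split: generator.split)
  then have "poly_eval scale a b (\<phi> (Poly_Mapping.single w 1)) = prod_list (map (case_generator
      (\<lambda>i. poly_eval scale a b (\<phi> (y_var i))) (\<lambda>j. poly_eval scale a b (\<phi> (z_var j)))) (letters w))"
    for w by (metis prod_list_var)
  then show ?thesis
    by (induction f rule: star_poly_induct)
      (simp_all add: \<phi>.zero \<phi>.add \<phi>.scale poly_eval_add poly_eval_scale)
qed

lemma T_star_space_central_polynomials: "T_star_space (star_central_polynomials scale star)"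
  unfolding T_star_space_def
proof (intro conjI allI impI image_subsetI)
  have "scale c x * y = y * scale c x" if "x * y = y * x" for c x y
    using that by (metis scale_mult_left scale_mult_right)
  then show "poly.subspace (star_central_polynomials scale star)"
    by (intro poly.subspaceI)
      (simp_all add: star_central_polynomials_def algebra_center_def poly_eval_add poly_eval_scale
        distrib_left distrib_right)
next
  fix \<phi> :: "'k star_poly \<Rightarrow> 'k star_poly" and f
  assume \<phi>: "star_endomorphism \<phi>" and f: "f \<in> star_central_polynomials scale star"
  have star: "poly_star (\<phi> f) = \<phi> (poly_star f)" for f
    using \<phi> by (simp add: star_endomorphism_def)
  interpret \<phi>: Vector_Spaces.linear poly_scale poly_scale \<phi>
    using \<phi> by (simp add: star_endomorphism_def)
  \<comment> \<open>\<open>\<phi>\<close> commutes with star, so evaluating \<open>\<phi> f\<close>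
    amounts to evaluating \<open>f\<close> at other admissible values.\<close>
  have "\<phi> (y_var i) \<in> symmetric_elements poly_star" and "\<phi> (z_var i) \<in> skew_elements poly_star" for i
    by (simp_all add: symmetric_elements_def skew_elements_def star poly_star_var \<phi>.neg)
  then show "\<phi> f \<in> star_central_polynomials scale star"
    using f unfolding star_central_polynomials_def
    by (subst mem_Collect_eq, subst poly_eval_star_endomorphism [OF \<phi>])
      (simp add: symmetric_poly_eval skew_poly_eval)
qed

end

text \<open>Substituting symmetric and skew polynomials is evaluation in the free algebra
  itself.\<close>

lemma star_endomorphism_poly_eval:
  assumes "\<And>i. a i \<in> symmetric_elements poly_star" "\<And>j. b j \<in> skew_elements poly_star"
  shows "star_endomorphism (poly_eval poly_scale a b)"
  unfolding star_endomorphism_def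
  by (auto intro!: Vector_Spaces.linear.intro module_hom.intro module_hom_axioms.intro
      poly.vector_space_axioms poly.module_axioms
      simp: poly.poly_eval_add poly.poly_eval_scale poly.poly_eval_mult poly.poly_eval_star assms)

text \<open>Both closure conditions survive arbitrary intersections, so the hull has them
  too.\<close>

lemma T_star_space_T_star_space_generated: "T_star_space (T_star_space_generated W)"
proof -
  have *: "T_star_space (\<Inter> \<V>)" if "\<And>V. V \<in> \<V> \<Longrightarrow> T_star_space V" for \<V> :: "'k::field star_poly set set"
    unfolding T_star_space_def
  proof (intro conjI allI impI image_subsetI InterI)
    show "poly.subspace (\<Inter> \<V>)"
      using that by (intro poly.subspace_Inter) (auto simp: T_star_space_def)
  qed (use that in \<open>auto simp: T_star_space_def image_subset_iff\<close>)
  show ?thesis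
    unfolding T_star_space_generated_def by (rule hull_in, rule *) blast
qed

lemma skew_mult_skew_in_T_star_space_generated:
  assumes "g \<in> skew_elements poly_star" "h \<in> skew_elements poly_star"
  shows "g * h \<in> T_star_space_generated {z_var 1 * z_var 2}"
proof -
  \<comment> \<open>The default 0 for the \<open>y_var i\<close> is symmetric; every
    \<open>z_var i\<close> other than \<open>z_var 1\<close> goes to \<open>h\<close>.\<close>
  define \<phi> where "\<phi> = poly_eval poly_scale (\<lambda>_. 0) (\<lambda>i. if i = 1 then g else h)"
  have "star_endomorphism \<phi>"
    unfolding \<phi>_def using assms
    by (intro star_endomorphism_poly_eval) (simp_all add: symmetric_elements_def poly_star_zero)
  moreover have "z_var 1 * z_var 2 \<in> T_star_space_generated {z_var 1 * z_var 2}"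
    unfolding T_star_space_generated_def by (rule hull_inc) simp
  ultimately have "\<phi> (z_var 1 * z_var 2) \<in> T_star_space_generated {z_var 1 * z_var 2}"
    using T_star_space_T_star_space_generated unfolding T_star_space_def by blast
  then show ?thesis
    by (simp add: \<phi>_def poly.poly_eval_mult)
qed


section \<open>Star-central polynomials of upper triangular matrices\<close>

lift_definition entry :: "'k::field ut2 \<Rightarrow> 2 \<Rightarrow> 2 \<Rightarrow> 'k" is "\<lambda>A i j. A $ i $ j" .

lemma entry_simps [simp]:
  "entry 0 i j = 0"
  "entry (A + B) i j = entry A i j + entry B i j"
  "entry (A - B) i j = entry A i j - entry B i j"
  "entry (- A) i j = - entry A i j"
  "entry (ut2_scale c A) i j = c * entry A i j"
  by (transfer; simp)+

lemma entry_2_1 [simp]: "entry A 2 1 = 0"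
  by transfer simp

lemma entry_one [simp]: "entry 1 1 1 = 1" "entry 1 1 2 = 0" "entry 1 2 2 = 1"
  by (transfer; simp add: mat_def)+

lemma entry_mult [simp]:
  "entry (A * B) 1 1 = entry A 1 1 * entry B 1 1"
  "entry (A * B) 1 2 = entry A 1 1 * entry B 1 2 + entry A 1 2 * entry B 2 2"
  "entry (A * B) 2 2 = entry A 2 2 * entry B 2 2"
  by (transfer; simp add: matrix_matrix_mult_def sum_2)+

lemma entry_star [simp]:
  "entry (ut2_star A) 1 1 = entry A 2 2"
  "entry (ut2_star A) 1 2 = entry A 1 2"
  "entry (ut2_star A) 2 2 = entry A 1 1"
  by (transfer; simp)+

lemma entry_sum: "entry (sum h S) i j = (\<Sum>s\<in>S. entry (h s) i j)"
  by (induction S rule: infinite_finite_induct) simp_all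

lemma ut2_eq_iff:
  "A = B \<longleftrightarrow> entry A 1 1 = entry B 1 1 \<and> entry A 1 2 = entry B 1 2 \<and> entry A 2 2 = entry B 2 2"
  by transfer (auto simp: vec_eq_iff forall_2)

lift_definition ut2_of :: "'k \<Rightarrow> 'k \<Rightarrow> 'k \<Rightarrow> 'k::field ut2" is
  "\<lambda>a c b. vector [vector [a, c], vector [0, b]]"
  by simp

lemma entry_ut2_of [simp]:
  "entry (ut2_of a c b) 1 1 = a"
  "entry (ut2_of a c b) 1 2 = c"
  "entry (ut2_of a c b) 2 2 = b"
  by (transfer; simp)+

lemma symmetric_ut2_iff: "A \<in> symmetric_elements ut2_star \<longleftrightarrow> entry A 1 1 = entry A 2 2"
  by (auto simp: symmetric_elements_def ut2_eq_iff)

text \<open>Star fixes the off-diagonal entry, so skewness makes it its own negative, hence 0 in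
  characteristic 0.\<close>

lemma skew_ut2_iff:
  "(A :: 'k::field_char_0 ut2) \<in> skew_elements ut2_star \<longleftrightarrow>
    entry A 2 2 = - entry A 1 1 \<and> entry A 1 2 = 0"
  by (auto simp: skew_elements_def ut2_eq_iff)

lemma central_ut2_iff: "A \<in> algebra_center \<longleftrightarrow> entry A 1 1 = entry A 2 2 \<and> entry A 1 2 = 0"
proof
  assume "A \<in> algebra_center"
  \<comment> \<open>Commuting with e_12 equates the diagonal entries; commuting with e_11 kills the
    off-diagonal one.\<close>
  then have "A * ut2_of 0 1 0 = ut2_of 0 1 0 * A" "A * ut2_of 1 0 0 = ut2_of 1 0 0 * A"
    by (simp_all add: algebra_center_def)
  then show "entry A 1 1 = entry A 2 2 \<and> entry A 1 2 = 0"
    by (simp add: ut2_eq_iff)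
qed (auto simp: algebra_center_def ut2_eq_iff mult.commute)

section \<open>Values of words and their degree in the skew variables\<close>

definition z_degree :: "generator list \<Rightarrow> nat" where
  "z_degree l = length (filter (\<lambda>g. case g of Y i \<Rightarrow> False | Z j \<Rightarrow> True) l)"

lemma z_degree_simps [simp]:
  "z_degree [] = 0"
  "z_degree (Y i # l) = z_degree l"
  "z_degree (Z j # l) = Suc (z_degree l)"
  "z_degree (l @ l') = z_degree l + z_degree l'"
  by (simp_all add: z_degree_def)

lemma z_degree_pos_split:
  assumes "z_degree l > 0"
  obtains p j q where "l = p @ Z j # q"
proof -
  have "\<exists>j. Z j \<in> set l"
    using assms
  proof (induction l)
    case (Cons g l)
    then show ?case
      by (cases g) auto
  qed simp
  then show thesis
    using that by (blast dest: split_list)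
qed

abbreviation word_value ::
  "(nat \<Rightarrow> 'k::field ut2) \<Rightarrow> (nat \<Rightarrow> 'k ut2) \<Rightarrow> generator list \<Rightarrow> 'k ut2" where
  "word_value a b l \<equiv> prod_list (map (case_generator a b) l)"

lemma entry_poly_eval:
  "entry (poly_eval ut2_scale a b f) i j =
    (\<Sum>w\<in>Poly_Mapping.keys f. Poly_Mapping.lookup f w * entry (word_value a b (letters w)) i j)"
  by (simp add: poly_eval_def entry_sum)

text \<open>Diagonals multiply entrywise; symmetric letters have equal diagonal entries, skew
  letters opposite ones.\<close>

lemma entry_word_value_diagonal:
  fixes a b :: "nat \<Rightarrow> 'k::field_char_0 ut2"
  assumes "\<And>i. a i \<in> symmetric_elements ut2_star" "\<And>j. b j \<in> skew_elements ut2_star"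
  shows "entry (word_value a b l) 2 2 = (-1) ^ z_degree l * entry (word_value a b l) 1 1"
proof (induction l)
  case (Cons g l)
  then show ?case
    using assms by (cases g) (simp_all add: symmetric_ut2_iff skew_ut2_iff)
qed simp

text \<open>
  The value of \<open>l\<close> at \<open>y\<^sub>i = t a\<^sub>i 1 + a\<^sub>i e\<^sub>1\<^sub>2\<close>, \<open>z\<^sub>j = 0\<close> is \<open>P(t) 1 + P'(t) e\<^sub>1\<^sub>2\<close>, because
  \<open>e\<^sub>1\<^sub>2\<close> squares to zero.
\<close>

lemma entry_word_value_pderiv:
  fixes a :: "nat \<Rightarrow> 'k::field_char_0"
  defines "v \<equiv> \<lambda>t. word_value (\<lambda>i. ut2_of (t * a i) (a i) (t * a i)) (\<lambda>_. 0)"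
    and "P \<equiv> \<lambda>l. prod_list (map (case_generator (\<lambda>i. [:0, a i:]) (\<lambda>_. 0)) l)"
  shows "entry (v t l) 1 1 = poly (P l) t \<and> entry (v t l) 1 2 = poly (pderiv (P l)) t \<and>
    entry (v t l) 2 2 = poly (P l) t"
proof (induction l)
  case (Cons g l)
  then show ?case
    unfolding v_def P_def
    by (cases g) (simp_all add: pderiv_mult pderiv_pCons pderiv_smult algebra_simps)
qed (simp add: v_def P_def)

text \<open>Scaling the diagonals of the \<open>a i\<close> by t turns the contribution of the pure
  y-words into a polynomial in t; it is constant, and comparing t = 1 with t = 0 leaves the constant
  term of \<open>f\<close>.\<close>

lemma central_polynomial_y_part:
  fixes f :: "'k::field_char_0 star_poly" and a b :: "nat \<Rightarrow> 'k ut2"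
  assumes f: "f \<in> star_central_polynomials ut2_scale ut2_star"
  shows "(\<Sum>w\<in>Poly_Mapping.keys f. if z_degree (letters w) = 0
      then Poly_Mapping.lookup f w * entry (word_value a b (letters w)) 1 1 else 0) =
    Poly_Mapping.lookup f 0"
proof -
  define a1 where "a1 i = entry (a i) 1 1" for i
  define Q where "Q l = prod_list (map (case_generator (\<lambda>i. [:0, a1 i:]) (\<lambda>_. 0)) l)" for l
  define P where "P = (\<Sum>w\<in>Poly_Mapping.keys f.
    smult (Poly_Mapping.lookup f w) (Q (letters w)))"
  have "poly (pderiv P) t = 0" for t
  proof -
    \<comment> \<open>The off-diagonal entry is the t-derivative of the diagonal one, so centrality
      of the value says that \<open>pderiv P\<close> vanishes at \<open>t\<close>.\<close>
    define y where "y i = ut2_of (t * a1 i) (a1 i) (t * a1 i)" for i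
    have "entry (poly_eval ut2_scale y (\<lambda>_. 0) f) 1 2 = 0"
      using f by (simp add: star_central_polynomials_def central_ut2_iff symmetric_ut2_iff
          skew_ut2_iff y_def)
    moreover have "entry (word_value y (\<lambda>_. 0) l) 1 2 = poly (pderiv (Q l)) t" for l
      unfolding y_def Q_def using entry_word_value_pderiv by blast
    ultimately show ?thesis
      by (simp add: entry_poly_eval P_def higher_pderiv_sum [where n = 1, simplified] pderiv_smult poly_sum)
  qed
  \<comment> \<open>Characteristic 0 enters twice: the field is infinite, so \<open>pderiv P\<close>
    is the zero polynomial, and a zero derivative forces degree 0.\<close>
  then have "pderiv P = 0"
    using poly_all_0_iff_0 by blast
  then have "degree P = 0"
    by (simp add: pderiv_eq_0_iff)
  then have P10: "poly P 1 = poly P 0"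
    by (metis degree_eq_zeroE mult_zero_right add_0_right poly_pCons poly_0)
  \<comment> \<open>At 1 the diagonals of the \<open>a i\<close> return, while a letter
    \<open>Z j\<close>, sent to 0, kills its word.\<close>
  have Q1: "poly (Q l) 1 = (if z_degree l = 0 then entry (word_value a b l) 1 1 else 0)" for l
  proof (induction l)
    case (Cons g l)
    then show ?case
      by (cases g) (simp_all add: Q_def a1_def)
  qed (simp add: Q_def)
  \<comment> \<open>At 0 every letter vanishes, so only the empty product survives.\<close>
  have Q0: "poly (Q (letters w)) 0 = (if w = 0 then 1 else 0)" for w
  proof (cases "letters w")
    case Nil
    then show ?thesis by (cases w) (simp add: Q_def zero_word_def)
  next
    case (Cons g l)
    then have "w \<noteq> 0" by auto
    then show ?thesis using Cons by (cases g) (simp_all add: Q_def)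
  qed
  have "poly P 0 = Poly_Mapping.lookup f 0"
    by (simp add: P_def poly_sum Q0 if_distrib in_keys_iff cong: if_cong)
  moreover have "poly P 1 = (\<Sum>w\<in>Poly_Mapping.keys f. if z_degree (letters w) = 0
      then Poly_Mapping.lookup f w * entry (word_value a b (letters w)) 1 1 else 0)"
    by (simp add: P_def poly_sum Q1 if_distrib cong: if_cong)
  ultimately show ?thesis
    using P10 by simp
qed

text \<open>Diagonal entries commute, so moving a letter \<open>Z j\<close> to the end keeps the
  upper left entry. The choice of \<open>g\<close> depends on \<open>l\<close> alone and serves all
  substitutions at once.\<close>

lemma even_word_representative:
  fixes l :: "generator list"
  assumes "even (z_degree l)" "z_degree l > 0"
  shows "\<exists>g :: 'k::field_char_0 star_poly. g \<in> T_star_space_generated {z_var 1 * z_var 2} \<and>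
    (\<forall>a b :: nat \<Rightarrow> 'k ut2. (\<forall>i. a i \<in> symmetric_elements ut2_star) \<longrightarrow>
      (\<forall>j. b j \<in> skew_elements ut2_star) \<longrightarrow>
      poly_eval ut2_scale a b g = ut2_scale (entry (word_value a b l) 1 1) 1)"
proof -
  obtain p j q where l: "l = p @ Z j # q"
    using assms(2) by (rule z_degree_pos_split)
  define u :: "'k star_poly" where "u = Poly_Mapping.single (Word (p @ q)) 1"
  \<comment> \<open>\<open>p @ q\<close> has odd degree, so its value has opposite diagonal entries;
    half the difference with its star keeps them and cancels the off-diagonal entry, which star
    fixes.\<close>
  define g where "g = poly_scale (1/2) (u - poly_star u) * z_var j"
  have "g \<in> T_star_space_generated {z_var 1 * z_var 2}"
    unfolding g_def
    by (intro skew_mult_skew_in_T_star_space_generated poly.skew_elements_minus_star)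
      (simp add: skew_elements_def poly_star_var)
  moreover have "poly_eval ut2_scale a b g = ut2_scale (entry (word_value a b l) 1 1) 1"
    if ab: "\<And>i. a i \<in> symmetric_elements ut2_star" "\<And>j. b j \<in> skew_elements ut2_star"
    for a b :: "nat \<Rightarrow> 'k ut2"
  proof -
    define U where "U = word_value a b (p @ q)"
    have "entry U 2 2 = - entry U 1 1"
      using entry_word_value_diagonal [OF ab, where l = "p @ q"] assms(1) by (simp add: U_def l)
    moreover have "poly_eval ut2_scale a b g = ut2_scale (1/2) (U - ut2_star U) * b j"
      by (simp add: g_def u_def U_def ut2.poly_eval_mult ut2.poly_eval_scale ut2.poly_eval_diff
          ut2.poly_eval_star [OF ab])
    moreover have "entry (b j) 2 2 = - entry (b j) 1 1" "entry (b j) 1 2 = 0"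
      using ab(2) [of j] by (simp_all add: skew_ut2_iff)
    moreover have "entry (word_value a b l) 1 1 = entry U 1 1 * entry (b j) 1 1"
      by (simp add: l U_def)
    ultimately show ?thesis
      by (simp add: ut2_eq_iff)
  qed
  ultimately show ?thesis
    by blast
qed

section \<open>The two inclusions between the central polynomials and the sum\<close>

theorem theorem4p6:
  shows "star_central_polynomials (ut2_scale :: 'k::field_char_0 \<Rightarrow> 'k ut2 \<Rightarrow> 'k ut2) ut2_star =
    star_identities (ut2_scale :: 'k \<Rightarrow> 'k ut2 \<Rightarrow> 'k ut2) ut2_star +
      T_star_space_generated {z_var 1 * z_var 2} + constants"
    (is "?C = ?I + ?T + _")
proof
  have sub: "poly.subspace ?C"
    by (rule conjunct1 [OF ut2.T_star_space_central_polynomials [unfolded T_star_space_def]])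
  \<comment> \<open>The product of diag(d, -d) and diag(d', -d') is the scalar matrix d d'.\<close>
  have "z_var 1 * z_var 2 \<in> ?C"
    by (simp add: star_central_polynomials_def ut2.poly_eval_mult central_ut2_iff skew_ut2_iff)
  then have "?T \<subseteq> ?C"
    unfolding T_star_space_generated_def
    by (intro hull_minimal ut2.T_star_space_central_polynomials) simp
  moreover have "?I \<subseteq> ?C"
    by (auto simp: star_identities_def star_central_polynomials_def central_ut2_iff)
  moreover have "constants \<subseteq> ?C"
    by (auto simp: constants_def star_central_polynomials_def central_ut2_iff ut2.poly_eval_scale)
  ultimately show "?I + ?T + constants \<subseteq> ?C"
    by (auto elim!: set_plus_elim intro!: poly.subspace_add [OF sub] simp del: One_nat_def)
next
  show "?C \<subseteq> ?I + ?T + constants"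
  proof
    fix f :: "'k star_poly"
    assume f: "f \<in> ?C"
    \<comment> \<open>Besides the pure y-words, only these words contribute to a central
      value.\<close>
    define E where "E = {w \<in> Poly_Mapping.keys f. even (z_degree (letters w)) \<and> z_degree (letters w) > 0}"
    have "\<forall>w\<in>E. \<exists>g. g \<in> ?T \<and> (\<forall>a b :: nat \<Rightarrow> 'k ut2.
        (\<forall>i. a i \<in> symmetric_elements ut2_star) \<longrightarrow> (\<forall>j. b j \<in> skew_elements ut2_star) \<longrightarrow>
        poly_eval ut2_scale a b g = ut2_scale (entry (word_value a b (letters w)) 1 1) 1)"
      unfolding E_def by (intro ballI even_word_representative) simp_all
    \<comment> \<open>Representatives are fixed before \<open>a\<close> and \<open>b\<close>, so
      that \<open>g\<close> below is a single polynomial.\<close>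
    from bchoice [OF this] obtain h where h: "\<And>w. w \<in> E \<Longrightarrow> h w \<in> ?T"
      and h_eval: "\<And>w a b. w \<in> E \<Longrightarrow> \<forall>i. a i \<in> symmetric_elements ut2_star \<Longrightarrow>
        \<forall>j. b j \<in> skew_elements ut2_star \<Longrightarrow>
        poly_eval ut2_scale a b (h w) = ut2_scale (entry (word_value a b (letters w)) 1 1) 1"
      by blast
    define g where "g = (\<Sum>w\<in>E. poly_scale (Poly_Mapping.lookup f w) (h w))"
    define c where "c = poly_scale (Poly_Mapping.lookup f 0) (1 :: 'k star_poly)"
    have "poly.subspace ?T"
      by (rule conjunct1 [OF T_star_space_T_star_space_generated [unfolded T_star_space_def]])
    then have "g \<in> ?T"
      unfolding g_def by (intro poly.subspace_sum poly.subspace_scale h)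
    moreover have "c \<in> constants"
      by (simp add: c_def constants_def)
    moreover have "f - g - c \<in> ?I"
      unfolding star_identities_def
    proof (intro CollectI allI impI)
      fix a b :: "nat \<Rightarrow> 'k ut2"
      assume a: "\<forall>i. a i \<in> symmetric_elements ut2_star" and b: "\<forall>j. b j \<in> skew_elements ut2_star"
      define \<delta> where "\<delta> w = entry (word_value a b (letters w)) 1 1" for w
      let ?\<alpha> = "Poly_Mapping.lookup f" and ?K = "Poly_Mapping.keys f"
      let ?z = "\<lambda>w. z_degree (letters w)"
      define v where "v = poly_eval ut2_scale a b f"
      have v: "entry v 1 1 = entry v 2 2" "entry v 1 2 = 0"
        using f a b by (auto simp: star_central_polynomials_def central_ut2_iff v_def)
      \<comment> \<open>The trace cancels words of odd degree and doubles those of even degree;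
        centrality makes it twice one entry.\<close>
      have "2 * entry v 1 1 = entry v 1 1 + entry v 2 2"
        using v by simp
      also have "\<dots> = (\<Sum>w\<in>?K. ?\<alpha> w * \<delta> w + ?\<alpha> w * ((-1) ^ ?z w * \<delta> w))"
        using a b by (simp add: v_def entry_poly_eval sum.distrib entry_word_value_diagonal \<delta>_def)
      also have "\<dots> = (\<Sum>w\<in>?K. 2 * ((if ?z w = 0 then ?\<alpha> w * \<delta> w else 0) +
          (if even (?z w) \<and> ?z w > 0 then ?\<alpha> w * \<delta> w else 0)))"
        by (intro sum.cong refl) auto
      also have "\<dots> = 2 * ((\<Sum>w\<in>?K. if ?z w = 0 then ?\<alpha> w * \<delta> w else 0) + (\<Sum>w\<in>E. ?\<alpha> w * \<delta> w))"
        by (simp add: sum.distrib sum_distrib_left [symmetric] E_def sum.inter_filter)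
      also have "(\<Sum>w\<in>?K. if ?z w = 0 then ?\<alpha> w * \<delta> w else 0) = ?\<alpha> 0"
        unfolding \<delta>_def by (rule central_polynomial_y_part [OF f])
      finally have "entry v 1 1 = ?\<alpha> 0 + (\<Sum>w\<in>E. ?\<alpha> w * \<delta> w)"
        by (rule mult_left_cancel [THEN iffD1, rotated]) simp
      moreover have "poly_eval ut2_scale a b g = (\<Sum>w\<in>E. ut2_scale (?\<alpha> w * \<delta> w) 1)"
        using a b by (simp add: g_def ut2.poly_eval_sum ut2.poly_eval_scale h_eval \<delta>_def)
      \<comment> \<open>The values of \<open>f\<close>, \<open>g\<close> and \<open>c\<close> are
        all scalar, so equality in one diagonal entry suffices.\<close>
      ultimately show "poly_eval ut2_scale a b (f - g - c) = 0"
        using v by (simp add: ut2_eq_iff ut2.poly_eval_diff ut2.poly_eval_scale c_def entry_sum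
            v_def [symmetric])
    qed
    ultimately have "(f - g - c) + g + c \<in> ?I + ?T + constants"
      by (intro set_plus_intro)
    then show "f \<in> ?I + ?T + constants"
      by simp
  qed
qed

end
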